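(* Let $L:\Theta\to\mathbb{R}$, maps $T_1,\dots,T_k:\Theta\to\Theta$, a starting value $\theta_0\in\Theta$, the compact set $\Theta_0=\{\theta\in\Theta\mid L(\theta)\ge L(\theta_0)\}$, and the sequence $(\theta_n)_{n\in\mathbb{N}}$ given by $\theta_{n+1}=T_k\cdots T_1(\theta_n)$, $n\ge0$, be as in the iterative partial maximization setting described in the context, and let $\mathcal{A}_\infty$ be the set of accumulation points of $(\theta_n)_{n\in\mathbb{N}}$. Then $\mathcal{A}_\infty$ is a compact and connected subset of $\Theta_0$.
   Context: Iterative partial maximization setting. $\Theta\subseteq\mathbb{R}^d$ is an open set and $L:\Theta\to\mathbb{R}$ is a differentiable function. The point $\theta_0\in\Theta$ is such that $\Theta_0=\{\theta\in\Theta\mid L(\theta)\ge L(\theta_0)\}$ is compact. For functions $g_i:\Theta\to\mathbb{R}^{d_i}$, $i=1,\dots,k$, and $\theta^*\in\Theta$, define the sections $$\Theta_i(\theta^* )=\{\theta\in\Theta\mid g_i(\theta)=g_i(\theta^* )\}.$$ Assume: (i) for all $\theta^*\in\Theta$ and $i=1,\dots,k$, the maximum of $L$ over $\Theta_i(\theta^* )$ is uniquely attained, and the associated map $T_i:\Theta\to\Theta$, $T_i(\theta^* )=\mathop{\mathrm{argmax}}_{\theta\in\Theta_i(\theta^* )}L(\theta)$, is continuous for every $i=1,\dots,k$; (ii) if $\theta^*\in\Theta$ maximizes $L$ over all sections $\Theta_i(\theta^* )$, $i=1,\dots,k$ (equivalently $\theta^*=T_i(\theta^* )$ for all $i$), then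 $\theta^*$ solves the likelihood equations $\frac{\partial L(\theta)}{\partial\theta}\big|_{\theta=\theta^*}=0$. The sequence is defined by $\theta_{n+1}=T_k\cdots T_1(\theta_n)$ (composition of maps) for $n\ge0$, starting at $\theta_0$. An accumulation point of the sequence is a limit of a convergent subsequence; since $\theta_n\in\Theta_0$ for all $n$ and $\Theta_0$ is compact, $\mathcal{A}_\infty\subseteq\Theta_0$. A compact set is connected if it cannot be partitioned into two nonempty compact sets. *)

theory Defs
  imports "HOL-Analysis.Analysis"
begin

text \<open>
  The map \<open>g\<^sub>i\<close> takes values in a Euclidean space whose dimension \<open>d i\<close> varies with \<open>i\<close>, so points
  of that space are given by their coordinates: \<open>g i \<theta> j\<close> for \<open>j < d i\<close> is a coordinate of \<open>g\<^sub>i(\<theta>)\<close>,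
  and values at \<open>j \<ge> d i\<close> are irrelevant.
\<close>

definition level_section ::
  "(real^'n) set \<Rightarrow> (nat \<Rightarrow> nat) \<Rightarrow> (nat \<Rightarrow> real^'n \<Rightarrow> nat \<Rightarrow> real) \<Rightarrow> nat \<Rightarrow> real^'n \<Rightarrow> (real^'n) set"
  where "level_section \<Theta> d g i \<theta>' = {\<theta> \<in> \<Theta>. \<forall>j < d i. g i \<theta> j = g i \<theta>' j}"

definition partial_max ::
  "(real^'n) set \<Rightarrow> (real^'n \<Rightarrow> real) \<Rightarrow> (nat \<Rightarrow> nat) \<Rightarrow> (nat \<Rightarrow> real^'n \<Rightarrow> nat \<Rightarrow> real) \<Rightarrow>
    nat \<Rightarrow> real^'n \<Rightarrow> real^'n"
  where "partial_max \<Theta> L d g i \<theta>' = arg_max_on L (level_section \<Theta> d g i \<theta>')"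

text \<open>Limits of convergent subsequences; this differs from the limit points of \<open>range X\<close>,
  e.g. for a constant sequence.\<close>

definition accumulation_points :: "(nat \<Rightarrow> 'a::topological_space) \<Rightarrow> 'a set"
  where "accumulation_points X = {a. \<exists>r. strict_mono r \<and> (X \<circ> r) \<longlonglongrightarrow> a}"

end

theory Submission
  imports Defs
begin

text \<open>
  Each partial maximization \<open>T\<^sub>i\<close> never decreases \<open>L\<close>, and by uniqueness of the maximizers it
  moves a point only if it strictly increases \<open>L\<close>. Both properties, and continuity, pass to the
  cycle \<open>S = T\<^sub>k \<cdots> T\<^sub>1\<close> (\<open>strict_ascent_fold\<close>). Hence \<open>L(\<theta>\<^sub>n)\<close> increases, and it is bounded because
  \<open>L\<close> is continuous and \<open>\<Theta>\<^sub>0\<close> compact, so it converges to some \<open>l\<close>.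
  If \<open>\<theta>\<^bsub>r(n)\<^esub> \<longlonglongrightarrow> a\<close>, then \<open>L(a) = l\<close>; but
  \<open>\<theta>\<^bsub>r(n)+1\<^esub> = S(\<theta>\<^bsub>r(n)\<^esub>) \<longlonglongrightarrow> S(a)\<close>, so \<open>L(S(a)) = l\<close> too, and therefore \<open>S(a) = a\<close>. Thus every
  accumulation point is fixed by \<open>S\<close> (\<open>strict_ascent_accumulation_point_fixed\<close>).

  Given these fixed points, connectedness needs only that \<open>S\<close> is continuous and \<open>\<Theta>\<^sub>0\<close> compact.
  Were the accumulation points divided between disjoint open sets \<open>U\<close> and \<open>V\<close>, each containing at
  least one of them, the sequence would visit both infinitely often, so it would jump out of \<open>U\<close>
  infinitely often. Along a convergent subsequence of the jumps, the points before and after the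
  jump have the same limit \<open>a = S(a)\<close>. If \<open>a \<in> U\<close>, the points after the jump eventually lie in
  \<open>U\<close>; if \<open>a \<in> V\<close>, the points before it eventually lie in \<open>V\<close>. Either is absurd
  (\<open>connected_accumulation_points\<close>).
\<close>

section \<open>Accumulation points of sequences\<close>

lemma accumulation_pointsI:
  "strict_mono r \<Longrightarrow> (X \<circ> r) \<longlonglongrightarrow> a \<Longrightarrow> a \<in> accumulation_points X"
  unfolding accumulation_points_def by blast

text \<open>This description by neighbourhoods, free of subsequences, makes closedness visible.\<close>

lemma accumulation_points_iff_frequently:
  fixes X :: "nat \<Rightarrow> 'a::metric_space"
  shows "a \<in> accumulation_points X \<longleftrightarrow>
    (\<forall>U. open U \<longrightarrow> a \<in> U \<longrightarrow> (\<exists>\<^sub>F n in sequentially. X n \<in> U))"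
proof
  assume "a \<in> accumulation_points X"
  then obtain r where r: "strict_mono r" "(X \<circ> r) \<longlonglongrightarrow> a"
    unfolding accumulation_points_def by blast
  show "\<forall>U. open U \<longrightarrow> a \<in> U \<longrightarrow> (\<exists>\<^sub>F n in sequentially. X n \<in> U)"
  proof (intro allI impI)
    fix U assume "open U" "a \<in> U"
    then have "\<forall>\<^sub>F n in sequentially. X (r n) \<in> U"
      using r(2) by (auto dest: topological_tendstoD)
    then have "\<exists>\<^sub>F n in sequentially. X (r n) \<in> U"
      by (simp add: eventually_frequently)
    then show "\<exists>\<^sub>F n in sequentially. X n \<in> U"
      using eventually_subseq[OF r(1), of "\<lambda>n. X n \<notin> U"] by (auto simp: frequently_def)
  qed
next
  assume freq: "\<forall>U. open U \<longrightarrow> a \<in> U \<longrightarrow> (\<exists>\<^sub>F n in sequentially. X n \<in> U)"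
  have ex: "\<exists>n>m. dist (X n) a < e" if "e > 0" for m e
  proof -
    have "\<exists>\<^sub>F n in sequentially. X n \<in> ball a e"
      using freq that by (meson centre_in_ball open_ball)
    then show ?thesis
      unfolding frequently_sequentially by (metis Suc_le_eq dist_commute mem_ball)
  qed
  obtain r :: "nat \<Rightarrow> nat"
    where r: "\<And>n. dist (X (r n)) a < inverse (Suc n)" "\<And>n. r n < r (Suc n)"
    using dependent_nat_choice[of "\<lambda>n m. dist (X m) a < inverse (Suc n)" "\<lambda>n. (<)"] ex
    by (metis inverse_positive_iff_positive of_nat_0_less_iff zero_less_Suc)
  have "(\<lambda>n. dist (X (r n)) a) \<longlonglongrightarrow> 0"
    by (rule tendsto_sandwich[OF _ _ tendsto_const LIMSEQ_inverse_real_of_nat])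
      (use r(1) in \<open>auto intro!: always_eventually less_imp_le simp del: of_nat_Suc\<close>)
  then have "(X \<circ> r) \<longlonglongrightarrow> a"
    by (simp add: tendsto_dist_iff[of _ a] o_def)
  then show "a \<in> accumulation_points X"
    using r(2) by (intro accumulation_pointsI) (auto simp: strict_mono_Suc_iff)
qed

lemma closed_accumulation_points:
  fixes X :: "nat \<Rightarrow> 'a::metric_space"
  shows "closed (accumulation_points X)"
proof -
  have "- accumulation_points X = \<Union>{U. open U \<and> (\<forall>\<^sub>F n in sequentially. X n \<notin> U)}"
    by (intro set_eqI)
      (simp add: accumulation_points_iff_frequently not_frequently, blast)
  then show ?thesis
    unfolding closed_def by (simp add: open_Union)
qed

lemma accumulation_points_subset_closed:
  assumes "closed K" "\<And>n. X n \<in> K"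
  shows "accumulation_points X \<subseteq> K"
  unfolding accumulation_points_def
  using closed_sequentially[OF assms(1), of "X \<circ> r" for r] assms(2) by auto

text \<open>In a compact set, infinitely many terms always accumulate, even those selected by a
  condition \<open>P\<close> on the index.\<close>

lemma frequently_imp_convergent_subsequence:
  fixes X :: "nat \<Rightarrow> 'a::metric_space"
  assumes "compact K" "\<And>n. X n \<in> K" "\<exists>\<^sub>F n in sequentially. P n"
  obtains a r where "strict_mono r" "(X \<circ> r) \<longlonglongrightarrow> a" "\<And>n. P (r n)"
proof -
  have inf: "infinite {n. P n}"
    using assms(3) by (simp add: frequently_cofinite cofinite_eq_sequentially[symmetric])
  define s where "s = enumerate {n. P n}"
  have s: "strict_mono s" "\<And>n. P (s n)"
    using strict_mono_enumerate[OF inf] enumerate_in_set[OF inf] by (auto simp: s_def)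
  obtain a q where q: "strict_mono q" "((X \<circ> s) \<circ> q) \<longlonglongrightarrow> a"
    using assms(1,2) unfolding compact_def by (metis comp_apply)
  show ?thesis
    by (rule that[of "s \<circ> q" a]) (use s q strict_mono_o in \<open>auto simp: o_assoc\<close>)
qed

lemma frequently_leave:
  assumes "\<exists>\<^sub>F n in sequentially. P n" "\<exists>\<^sub>F n in sequentially. \<not> P n"
  shows "\<exists>\<^sub>F n in sequentially. P n \<and> \<not> P (Suc n)"
  unfolding frequently_sequentially
proof
  fix N
  obtain m where m: "m \<ge> N" "P m"
    using assms(1) unfolding frequently_sequentially by blast
  obtain m' where m': "m' \<ge> m" "\<not> P m'"
    using assms(2) unfolding frequently_sequentially by blast
  have "\<exists>n\<ge>m. P n \<and> \<not> P (Suc n)"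
    using m'(1,2) m(2) by (induction rule: dec_induct) auto
  with m(1) show "\<exists>n\<ge>N. P n \<and> \<not> P (Suc n)"
    by (meson order_trans)
qed

text \<open>The last hypothesis says that a shift by one does not change the limits of convergent
  subsequences. In a compact set it amounts to \<open>dist (X (Suc n)) (X n) \<longlonglongrightarrow> 0\<close>, but this form is what
  an argument with open sets uses directly.\<close>

lemma connected_accumulation_points:
  fixes X :: "nat \<Rightarrow> 'a::metric_space"
  assumes K: "compact K" "\<And>n. X n \<in> K"
    and shift: "\<And>r a. strict_mono r \<Longrightarrow> (X \<circ> r) \<longlonglongrightarrow> a \<Longrightarrow> (\<lambda>n. X (Suc (r n))) \<longlonglongrightarrow> a"
  shows "connected (accumulation_points X)"
proof (rule ccontr)
  assume "\<not> ?thesis"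
  then obtain A B where AB: "closed A" "closed B" "A \<noteq> {}" "B \<noteq> {}"
      "A \<union> B = accumulation_points X" "A \<inter> B = {}"
    using connected_closed_set[OF closed_accumulation_points[of X]] by blast
  obtain U V where UV: "open U" "open V" "A \<subseteq> U" "B \<subseteq> V" "U \<inter> V = {}"
    using t4_space[OF AB(1,2,6)] by blast
  have "\<exists>\<^sub>F n in sequentially. X n \<in> U"
    using AB UV accumulation_points_iff_frequently[of _ X] by blast
  moreover have "\<exists>\<^sub>F n in sequentially. X n \<in> V"
    using AB UV accumulation_points_iff_frequently[of _ X] by blast
  then have "\<exists>\<^sub>F n in sequentially. X n \<notin> U"
    by (rule frequently_elim1) (use UV in blast)
  ultimately have "\<exists>\<^sub>F n in sequentially. X n \<in> U \<and> X (Suc n) \<notin> U"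
    by (rule frequently_leave)
  then obtain a r where r: "strict_mono r" "(X \<circ> r) \<longlonglongrightarrow> a"
      "\<And>n. X (r n) \<in> U \<and> X (Suc (r n)) \<notin> U"
    using frequently_imp_convergent_subsequence[where X = X, OF K] by blast
  have "a \<in> U \<or> a \<in> V"
    using accumulation_pointsI[OF r(1,2)] AB(5) UV by blast
  then show False
  proof
    assume "a \<in> U"
    then have "\<forall>\<^sub>F n in sequentially. X (Suc (r n)) \<in> U"
      using topological_tendstoD[OF shift[OF r(1,2)] UV(1)] by simp
    with r(3) show False by simp
  next
    assume "a \<in> V"
    then have "\<forall>\<^sub>F n in sequentially. X (r n) \<in> V"
      using topological_tendstoD[OF r(2) UV(2)] by simp
    then obtain n where "X (r n) \<in> V"
      by (auto simp: eventually_sequentially)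
    with r(3) UV(5) show False by blast
  qed
qed

section \<open>Maps that strictly increase a function unless they fix the point\<close>

definition strict_ascent ::
  "'a::topological_space set \<Rightarrow> ('a \<Rightarrow> real) \<Rightarrow> ('a \<Rightarrow> 'a) \<Rightarrow> bool"
  where "strict_ascent D L F \<longleftrightarrow> continuous_on D F \<and>
    (\<forall>x\<in>D. F x \<in> D \<and> L x \<le> L (F x) \<and> (L (F x) = L x \<longrightarrow> F x = x))"

lemma strict_ascent_id: "strict_ascent D L id"
  by (simp add: strict_ascent_def)

text \<open>If a composition keeps \<open>L\<close> constant at a point, then neither factor increases \<open>L\<close>, so both
  factors fix the point.\<close>

lemma strict_ascent_comp:
  assumes "strict_ascent D L F" "strict_ascent D L G"
  shows "strict_ascent D L (G \<circ> F)"
proof -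
  have "continuous_on D (G \<circ> F)"
    using assms unfolding strict_ascent_def
    by (intro continuous_on_compose) (auto intro: continuous_on_subset)
  moreover have "G (F x) = x" if "x \<in> D" "L (G (F x)) = L x" for x
  proof -
    have "L x \<le> L (F x)" "L (F x) \<le> L (G (F x))"
      using assms that(1) by (auto simp: strict_ascent_def)
    with that(2) have "L (F x) = L x" "L (G (F x)) = L (F x)"
      by auto
    then show ?thesis
      using assms that(1) by (auto simp: strict_ascent_def)
  qed
  moreover have "G (F x) \<in> D" "L x \<le> L (G (F x))" if "x \<in> D" for x
  proof -
    have "F x \<in> D" "L x \<le> L (F x)"
      using assms(1) that by (auto simp: strict_ascent_def)
    moreover from this(1) have "G (F x) \<in> D" "L (F x) \<le> L (G (F x))"
      using assms(2) by (auto simp: strict_ascent_def)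
    ultimately show "G (F x) \<in> D" "L x \<le> L (G (F x))"
      by auto
  qed
  ultimately show ?thesis
    by (simp add: strict_ascent_def)
qed

lemma strict_ascent_fold:
  "(\<And>i. i \<in> set is \<Longrightarrow> strict_ascent D L (T i)) \<Longrightarrow> strict_ascent D L (fold T is)"
  by (induction "is") (auto intro: strict_ascent_comp strict_ascent_id)

text \<open>Uniqueness is what makes the ascent strict: the starting point lies in its own section, so
  if its value is maximal there, it is the maximizer.\<close>

lemma strict_ascent_partial_max:
  assumes unique: "\<And>\<theta>'. \<theta>' \<in> \<Theta> \<Longrightarrow>
      \<exists>!\<eta>. is_arg_max L (\<lambda>\<eta>. \<eta> \<in> level_section \<Theta> d g i \<theta>') \<eta>"
    and cont: "continuous_on \<Theta> (partial_max \<Theta> L d g i)"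
  shows "strict_ascent \<Theta> L (partial_max \<Theta> L d g i)"
  unfolding strict_ascent_def
proof (intro conjI ballI cont)
  fix x assume x: "x \<in> \<Theta>"
  let ?y = "partial_max \<Theta> L d g i x"
  let ?max = "is_arg_max L (\<lambda>\<eta>. \<eta> \<in> level_section \<Theta> d g i x)"
  have max: "?max ?y"
    unfolding partial_max_def arg_max_on_def arg_max_def
    using unique[OF x] by (metis (mono_tags) someI_ex)
  have xs: "x \<in> level_section \<Theta> d g i x"
    using x by (simp add: level_section_def)
  show "?y \<in> \<Theta>"
    using max by (auto simp: is_arg_max_def level_section_def)
  show "L x \<le> L ?y"
    using max xs by (auto simp: is_arg_max_def not_less)
  show "L ?y = L x \<longrightarrow> ?y = x"
  proof
    assume "L ?y = L x"
    then have "?max x"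
      using max xs by (auto simp: is_arg_max_def)
    with max unique[OF x] show "?y = x"
      by blast
  qed
qed

lemma strict_ascent_accumulation_point_fixed:
  fixes x :: "nat \<Rightarrow> 'a::metric_space"
  assumes S: "strict_ascent D L S" and L: "continuous_on D L"
    and K: "compact K" "K \<subseteq> D" "\<And>n. x n \<in> K"
    and step: "\<And>n. x (Suc n) = S (x n)"
    and r: "strict_mono r" "(x \<circ> r) \<longlonglongrightarrow> a"
  shows "S a = a" "(\<lambda>n. x (Suc (r n))) \<longlonglongrightarrow> a"
proof -
  have "a \<in> K"
    using accumulation_points_subset_closed[where X = x, OF compact_imp_closed[OF K(1)] K(3)]
      accumulation_pointsI[OF r] by blast
  then have a: "a \<in> D" "S a \<in> D" and xD: "x n \<in> D" for n
    using K S by (auto simp: strict_ascent_def)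
  have "incseq (\<lambda>n. L (x n))"
    using S xD by (auto simp: incseq_Suc_iff step strict_ascent_def)
  moreover have "bounded (L ` K)"
    using K L by (intro compact_imp_bounded compact_continuous_image) (auto intro: continuous_on_subset)
  then obtain M where "\<And>y. y \<in> K \<Longrightarrow> \<bar>L y\<bar> \<le> M"
    unfolding bounded_iff by (auto simp: image_iff)
  then have "L (x n) \<le> M" for n
    using K(3)[of n] abs_le_D1 by blast
  ultimately obtain l where l: "(\<lambda>n. L (x n)) \<longlonglongrightarrow> l"
    using incseq_convergent[of "\<lambda>n. L (x n)" M] by blast
  have Sx: "(\<lambda>n. x (Suc (r n))) \<longlonglongrightarrow> S a"
    using continuous_on_tendsto_compose[of D S "x \<circ> r"] S r(2) a(1) xD
    by (auto simp: step strict_ascent_def o_def)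
  have "(\<lambda>n. L (x (r n))) \<longlonglongrightarrow> L a"
    using continuous_on_tendsto_compose[OF L r(2) a(1)] xD by (simp add: o_def)
  moreover have "(\<lambda>n. L (x (r n))) \<longlonglongrightarrow> l"
    using LIMSEQ_subseq_LIMSEQ[OF l r(1)] by (simp add: o_def)
  ultimately have "L a = l"
    by (rule LIMSEQ_unique)
  have "(\<lambda>n. L (x (Suc (r n)))) \<longlonglongrightarrow> L (S a)"
    using continuous_on_tendsto_compose[OF L Sx a(2)] xD by simp
  moreover have "(\<lambda>n. L (x (Suc (r n)))) \<longlonglongrightarrow> l"
    using LIMSEQ_subseq_LIMSEQ[OF LIMSEQ_Suc[OF l] r(1)] by (simp add: o_def)
  ultimately have "L (S a) = l"
    by (rule LIMSEQ_unique)
  with \<open>L a = l\<close> show "S a = a"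
    using S a(1) by (auto simp: strict_ascent_def)
  with Sx show "(\<lambda>n. x (Suc (r n))) \<longlonglongrightarrow> a"
    by simp
qed

section \<open>Iterative partial maximization\<close>

theorem theorem3:
  fixes \<Theta> :: "(real^'n) set"
    and L :: "real^'n \<Rightarrow> real"
    and k :: nat
    and d :: "nat \<Rightarrow> nat"
    and g :: "nat \<Rightarrow> real^'n \<Rightarrow> nat \<Rightarrow> real"
    and \<theta>\<^sub>0 :: "real^'n"
    and \<theta> :: "nat \<Rightarrow> real^'n"
  defines "\<Theta>\<^sub>0 \<equiv> {\<eta> \<in> \<Theta>. L \<eta> \<ge> L \<theta>\<^sub>0}"
    and "T \<equiv> partial_max \<Theta> L d g"
  assumes "open \<Theta>"
    and "L differentiable_on \<Theta>"
    and "\<theta>\<^sub>0 \<in> \<Theta>"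
    and "compact \<Theta>\<^sub>0"
    and unique_max: "\<And>i \<theta>'. i \<in> {1..k} \<Longrightarrow> \<theta>' \<in> \<Theta> \<Longrightarrow>
          \<exists>!\<eta>. is_arg_max L (\<lambda>\<eta>. \<eta> \<in> level_section \<Theta> d g i \<theta>') \<eta>"
    and continuous_T: "\<And>i. i \<in> {1..k} \<Longrightarrow> continuous_on \<Theta> (T i)"
    and stationary: "\<And>\<theta>'. \<theta>' \<in> \<Theta> \<Longrightarrow>
          (\<forall>i\<in>{1..k}. is_arg_max L (\<lambda>\<eta>. \<eta> \<in> level_section \<Theta> d g i \<theta>') \<theta>') \<Longrightarrow>
          (L has_derivative (\<lambda>_. 0)) (at \<theta>')"
    and "\<theta> 0 = \<theta>\<^sub>0"
    and step: "\<And>n. \<theta> (Suc n) = fold T [1..<Suc k] (\<theta> n)"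
  shows "accumulation_points \<theta> \<subseteq> \<Theta>\<^sub>0 \<and> compact (accumulation_points \<theta>)
    \<and> connected (accumulation_points \<theta>)"
proof -
  have S: "strict_ascent \<Theta> L (fold T [1..<Suc k])"
  proof (rule strict_ascent_fold)
    fix i assume "i \<in> set [1..<Suc k]"
    then have i: "i \<in> {1..k}"
      by auto
    show "strict_ascent \<Theta> L (T i)"
      using strict_ascent_partial_max[OF unique_max[OF i]] continuous_T[OF i]
      by (simp add: T_def)
  qed
  have in_\<Theta>\<^sub>0: "\<theta> n \<in> \<Theta>\<^sub>0" for n
  proof (induction n)
    case 0
    show ?case
      using \<open>\<theta> 0 = \<theta>\<^sub>0\<close> \<open>\<theta>\<^sub>0 \<in> \<Theta>\<close> by (simp add: \<Theta>\<^sub>0_def)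
  next
    case (Suc n)
    then show ?case
      using S unfolding step \<Theta>\<^sub>0_def strict_ascent_def by force
  qed
  have sub: "accumulation_points \<theta> \<subseteq> \<Theta>\<^sub>0"
    by (rule accumulation_points_subset_closed[OF compact_imp_closed[OF \<open>compact \<Theta>\<^sub>0\<close>] in_\<Theta>\<^sub>0])
  have "compact (accumulation_points \<theta>)"
    using compact_Int_closed[OF \<open>compact \<Theta>\<^sub>0\<close> closed_accumulation_points[of \<theta>]] sub
    by (simp add: Int_absorb1)
  moreover have "connected (accumulation_points \<theta>)"
  proof (rule connected_accumulation_points[OF \<open>compact \<Theta>\<^sub>0\<close> in_\<Theta>\<^sub>0])
    have "continuous_on \<Theta> L"
      by (rule differentiable_imp_continuous_on) fact
    moreover have "\<Theta>\<^sub>0 \<subseteq> \<Theta>"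
      by (auto simp: \<Theta>\<^sub>0_def)
    ultimately show "(\<lambda>n. \<theta> (Suc (r n))) \<longlonglongrightarrow> a" if "strict_mono r" "(\<theta> \<circ> r) \<longlonglongrightarrow> a" for r a
      using strict_ascent_accumulation_point_fixed(2)
        [OF S _ \<open>compact \<Theta>\<^sub>0\<close> _ in_\<Theta>\<^sub>0 step that] by blast
  qed
  ultimately show ?thesis
    using sub by blast
qed

end
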